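(* There is an absolute constant $C$ such that for all $n$ and $W$, $$\mathrm{vufg}(n,W)\le C\cdot\max\{\mathrm{vuufg}(n',W') : n'\le Cn,\ W'\le CW\}.$$
   Context: For a directed graph $G=(V,E)$ with nonnegative vertex weights $w$, $\mathrm{vdist}_w(s,t)$ is the minimum over $s\leadsto t$ paths $\pi$ of the total weight of the interior vertices of $\pi$. A set $X\subseteq V$ is an integral vertex cut for the pairs at vertex-weighted distance $\ge1$ if for every $(s,t)$ with $\mathrm{vdist}_w(s,t)\ge1$, every $s\leadsto t$ path contains an internal node (other than $s,t$) in $X$. $\mathrm{vufg}(n,W)$ is the least integer such that for every $n$-node directed graph with all vertex costs equal to $1$ and nonnegative vertex weights $w$ with $w(V)=W$, there is such an integral vertex cut $X$ with $|X|\le\langle\mathrm{cost},w\rangle\cdot\mathrm{vufg}(n,W)$ (here $\langle\mathrm{cost},w\rangle=w(V)$). $\mathrm{vuufg}(n,W)$ is defined the same way but only over instances in which additionally all vertices have the same weight. *)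

theory Defs
  imports
    "Graph_Theory.Pair_Digraph"
    "Graph_Theory.Vertex_Walk"
    "HOL-Library.Extended_Real"
begin

definition st_paths :: "'a pair_pre_digraph \<Rightarrow> 'a \<Rightarrow> 'a \<Rightarrow> 'a vwalk set" where
  "st_paths G s t = {p. vpath p (with_proj G) \<and> hd p = s \<and> last p = t}"

definition interior :: "'a vwalk \<Rightarrow> 'a list" where
  "interior p = butlast (tl p)"

text \<open>
  In a finite digraph there are finitely many paths from \<open>s\<close> to \<open>t\<close>, so the infimum is a minimum
  whenever \<open>t\<close> is reachable from \<open>s\<close>; otherwise it is \<open>\<infinity>\<close>.
\<close>
definition vdist :: "'a pair_pre_digraph \<Rightarrow> ('a \<Rightarrow> real) \<Rightarrow> 'a \<Rightarrow> 'a \<Rightarrow> ereal" where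
  "vdist G w s t = (INF p \<in> st_paths G s t. ereal (\<Sum>v\<in>set (interior p). w v))"

definition integral_vertex_cut :: "'a pair_pre_digraph \<Rightarrow> ('a \<Rightarrow> real) \<Rightarrow> 'a set \<Rightarrow> bool" where
  "integral_vertex_cut G w X \<longleftrightarrow>
     X \<subseteq> pverts G \<and>
     (\<forall>s\<in>pverts G. \<forall>t\<in>pverts G. vdist G w s t \<ge> 1 \<longrightarrow>
        (\<forall>p\<in>st_paths G s t. set (interior p) \<inter> X \<noteq> {}))"

definition weighted_instance ::
    "nat \<Rightarrow> real \<Rightarrow> 'a pair_pre_digraph \<Rightarrow> ('a \<Rightarrow> real) \<Rightarrow> bool" where
  "weighted_instance n W G w \<longleftrightarrow>
     pair_fin_digraph G \<and> card (pverts G) = n \<and>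
     (\<forall>v\<in>pverts G. 0 \<le> w v) \<and> (\<Sum>v\<in>pverts G. w v) = W"

text \<open>
  Every finite digraph is isomorphic to one whose vertices are natural numbers, so it suffices to
  quantify over those. With unit costs the cost of \<open>X\<close> is its cardinality and the inner product of
  costs and weights is the total weight. The least value is taken over the natural numbers: this
  excludes only negative integers, which matters only where the defining condition does not force
  nonnegativity (for \<open>W = 0\<close>, or without any instances).
\<close>
definition vufg :: "nat \<Rightarrow> real \<Rightarrow> nat" where
  "vufg n W = (LEAST k. \<forall>(G :: nat pair_pre_digraph) w. weighted_instance n W G w \<longrightarrow>
     (\<exists>X. integral_vertex_cut G w X \<and> real (card X) \<le> (\<Sum>v\<in>pverts G. w v) * real k))"

definition vuufg :: "nat \<Rightarrow> real \<Rightarrow> nat" where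
  "vuufg n W = (LEAST k. \<forall>(G :: nat pair_pre_digraph) w.
     weighted_instance n W G w \<and> (\<forall>u\<in>pverts G. \<forall>v\<in>pverts G. w u = w v) \<longrightarrow>
     (\<exists>X. integral_vertex_cut G w X \<and> real (card X) \<le> (\<Sum>v\<in>pverts G. w v) * real k))"

text \<open>The value \<open>n\<close> always satisfies the defining condition, so both least values are attained.\<close>

lemma interior_subset:
  assumes "p \<in> st_paths G s t"
  shows "set (interior p) \<subseteq> pverts G"
proof -
  have "set p \<subseteq> pverts G"
    using assms by (auto simp: st_paths_def vpath_def vwalk_def)
  then show ?thesis
    unfolding interior_def by (meson in_set_butlastD list_set_tl subset_iff)
qed

lemma cut_le_size:
  assumes inst: "weighted_instance n W G w"
  shows "\<exists>X. integral_vertex_cut G w X \<and> real (card X) \<le> (\<Sum>v\<in>pverts G. w v) * real n"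
proof -
  have fin: "finite (pverts G)" and n: "card (pverts G) = n"
    and nonneg: "\<And>v. v \<in> pverts G \<Longrightarrow> 0 \<le> w v" and W: "(\<Sum>v\<in>pverts G. w v) = W"
    using inst by (auto simp: weighted_instance_def dest: pair_fin_digraph.pair_finite_verts)
  have far: "1 \<le> (\<Sum>v\<in>set (interior p). w v)"
    if "vdist G w s t \<ge> 1" "p \<in> st_paths G s t" for s t p
  proof -
    have "vdist G w s t \<le> ereal (\<Sum>v\<in>set (interior p). w v)"
      unfolding vdist_def using that(2) by (rule INF_lower)
    with that(1) have "1 \<le> ereal (\<Sum>v\<in>set (interior p). w v)" by (rule order_trans)
    then show ?thesis by simp
  qed
  show ?thesis
  proof (cases "W \<ge> 1")
    case True
    have "set (interior p) \<inter> pverts G \<noteq> {}"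
      if "vdist G w s t \<ge> 1" "p \<in> st_paths G s t" for s t p
      using far[OF that] Int_absorb2[OF interior_subset[OF that(2)]] by (metis not_one_le_zero sum.empty)
    then have "integral_vertex_cut G w (pverts G)"
      by (auto simp: integral_vertex_cut_def)
    moreover have "real (card (pverts G)) \<le> W * real n"
      using True n mult_right_mono[of 1 W "real n"] by simp
    ultimately show ?thesis using W by blast
  next
    case False
    have "\<not> vdist G w s t \<ge> 1" if "p \<in> st_paths G s t" for s t p
      using far[OF _ that] False W
        sum_mono2[OF fin interior_subset[OF that], of w] nonneg by fastforce
    then have "integral_vertex_cut G w {}"
      by (auto simp: integral_vertex_cut_def)
    moreover have "0 \<le> (\<Sum>v\<in>pverts G. w v)"
      using nonneg by (simp add: sum_nonneg)
    ultimately show ?thesis by (intro exI[of _ "{}"]) simp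
  qed
qed

lemma vuufg_le: "vuufg n W \<le> n"
  unfolding vuufg_def by (rule Least_le) (use cut_le_size in blast)

lemma finite_vuufg_values:
  "finite {vuufg n' W' | n' W'. real n' \<le> B \<and> 0 \<le> W' \<and> W' \<le> D}"
proof (rule finite_subset)
  show "{vuufg n' W' | n' W'. real n' \<le> B \<and> 0 \<le> W' \<and> W' \<le> D} \<subseteq> {..nat \<lfloor>B\<rfloor>}"
    using vuufg_le le_nat_floor order_trans by (smt (verit) atMost_iff mem_Collect_eq subsetI)
qed simp

end

theory Submission
  imports Defs "HOL-Library.Nat_Bijection"
begin

text \<open>
  Subdivide the weights into quanta of size \<open>\<delta> = W / n\<close>: replace every vertex \<open>v\<close> by a directed
  chain of \<open>\<lfloor>w v / \<delta>\<rfloor> + 1\<close> copies of weight \<open>\<delta>\<close> each, entered only at the first copy and left only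
  at the last one. There are at most \<open>2 n\<close> copies, of total weight at most \<open>2 W\<close>. A path from the
  last copy of \<open>s\<close> to the first copy of \<open>t\<close> traverses the whole chain of every vertex it meets other
  than \<open>s\<close> and \<open>t\<close>, so distances do not decrease, and a vertex cut of the chain graph projects to a
  vertex cut of the original graph that is no larger.
\<close>

section \<open>Interiors of paths and elementary facts on walks\<close>

lemma set_interior:
  assumes "distinct p" "hd p \<noteq> last p"
  shows "set (interior p) = set p - {hd p, last p}"
proof (cases p)
  case (Cons a q)
  with assms have "q \<noteq> []" by auto
  then have "q = butlast q @ [last q]" by simp
  then obtain r b where "q = r @ [b]" by blast
  with Cons assms show ?thesis by (auto simp: interior_def)
qed (simp add: interior_def)

lemma st_paths_hd_last:
  assumes "p \<in> st_paths G s t" "s \<noteq> t"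
  shows "p = s # interior p @ [t]"
proof (cases p)
  case Nil
  with assms show ?thesis by (auto simp: st_paths_def vpath_def vwalk_def)
next
  case (Cons a q)
  with assms have "q \<noteq> []" "a = s" "last q = t" by (auto simp: st_paths_def split: if_splits)
  then show ?thesis using Cons append_butlast_last_id[of q] by (simp add: interior_def)
qed

text \<open>Both directions of the transfer between graphs produce walks, while distances and cuts
  speak of paths. Removing cycles keeps the ends and only discards vertices.\<close>

lemma vwalk_imp_st_path:
  assumes "vwalk p (with_proj G)"
  obtains q where "q \<in> st_paths G (hd p) (last p)" "set q \<subseteq> set p"
proof
  show "vwalk_to_vpath p \<in> st_paths G (hd p) (last p)"
    using assms by (simp add: st_paths_def vwalk_to_vpath_vpath vwalk_to_vpath_hd vwalk_to_vpath_last)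
  show "set (vwalk_to_vpath p) \<subseteq> set p"
    by (auto intro: vwalk_to_vpath_subset)
qed

lemma vwalk_pred:
  assumes "vwalk p G" "x \<in> set p" "x \<noteq> hd p"
  shows "\<exists>y\<in>set p. (y, x) \<in> arcs_ends G"
  using assms by (induction rule: vwalk_induct) auto

lemma vwalk_succ:
  assumes "vwalk p G" "x \<in> set p" "x \<noteq> last p"
  shows "\<exists>y\<in>set p. (x, y) \<in> arcs_ends G"
  using assms by (induction rule: vwalk_induct) (auto split: if_splits)

lemma vdist_self:
  assumes "s \<in> pverts G"
  shows "vdist G w s s \<le> 0"
proof -
  have "[s] \<in> st_paths G s s"
    using assms by (auto simp: st_paths_def vpath_def vwalk_def)
  then have "vdist G w s s \<le> ereal (\<Sum>v\<in>set (interior [s]). w v)"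
    unfolding vdist_def by (rule INF_lower)
  then show ?thesis by (simp add: interior_def zero_ereal_def)
qed

section \<open>The chain graph\<close>

definition chain_graph :: "(nat \<Rightarrow> nat) \<Rightarrow> nat pair_pre_digraph \<Rightarrow> nat pair_pre_digraph" where
  "chain_graph k G =
     \<lparr> pverts = prod_encode ` (SIGMA v:pverts G. {..<k v}),
       parcs = {(prod_encode (v, i), prod_encode (v, Suc i)) | v i. v \<in> pverts G \<and> Suc i < k v} \<union>
               {(prod_encode (u, k u - 1), prod_encode (v, 0)) | u v. (u, v) \<in> parcs G} \<rparr>"

abbreviation orig :: "nat \<Rightarrow> nat" where
  "orig x \<equiv> fst (prod_decode x)"

lemma pverts_chain_graph: "pverts (chain_graph k G) = prod_encode ` (SIGMA v:pverts G. {..<k v})"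
  by (simp add: chain_graph_def)

lemma prod_encode_in_pverts_chain_graph [simp]:
  "prod_encode (v, i) \<in> pverts (chain_graph k G) \<longleftrightarrow> v \<in> pverts G \<and> i < k v"
  by (auto simp: pverts_chain_graph)

lemma card_prod_encode_Sigma:
  assumes "finite A"
  shows "card (prod_encode ` (SIGMA v:A. {..<k v})) = (\<Sum>v\<in>A. k v)"
  using assms by (simp add: card_image inj_prod_encode)

lemma prod_encode_neq:
  assumes "v \<noteq> orig x"
  shows "prod_encode (v, i) \<noteq> x"
  using assms by auto

locale chain_digraph = pair_fin_digraph G for G :: "nat pair_pre_digraph" +
  fixes k :: "nat \<Rightarrow> nat"
  assumes k_pos: "0 < k v"
begin

abbreviation "H \<equiv> chain_graph k G"

lemma pair_fin_digraph_chain_graph: "pair_fin_digraph H"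
proof
  show arcs: "fst e \<in> pverts H" "snd e \<in> pverts H" if "e \<in> parcs H" for e
    using that k_pos by (auto simp: chain_graph_def dest: in_arcsD1 in_arcsD2)
  show fin: "finite (pverts H)"
    using pair_finite_verts by (simp add: pverts_chain_graph)
  have "parcs H \<subseteq> pverts H \<times> pverts H"
    using arcs by (auto simp: mem_Times_iff simp del: prod.collapse)
  then show "finite (parcs H)"
    by (rule finite_subset) (intro finite_cartesian_product fin)
qed

lemma chain_arc_in:
  assumes "(y, prod_encode (v, Suc i)) \<in> parcs H"
  shows "y = prod_encode (v, i)"
  using assms by (auto simp: chain_graph_def)

lemma chain_arc_out:
  assumes "(prod_encode (v, i), y) \<in> parcs H" "Suc i < k v"
  shows "y = prod_encode (v, Suc i)"
  using assms by (auto simp: chain_graph_def)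

lemma orig_arc:
  assumes "(x, y) \<in> parcs H"
  shows "orig x = orig y \<or> (orig x, orig y) \<in> parcs G"
  using assms by (auto simp: chain_graph_def)

section \<open>Walks, distances and cuts in \<open>G\<close> and in \<open>H\<close>\<close>

lemma vwalk_orig:
  assumes "vwalk p (with_proj H)"
  shows "\<exists>q. vwalk q (with_proj G) \<and> hd q = orig (hd p) \<and> last q = orig (last p) \<and>
           set q \<subseteq> orig ` set p"
  using assms
proof (induction rule: vwalk_induct)
  case (Base x)
  then have "orig x \<in> pverts G" by (auto simp: pverts_chain_graph)
  then show ?case by (intro exI[of _ "[orig x]"]) (auto simp: vwalk_def)
next
  case (Cons x y p)
  then obtain q where q: "vwalk q (with_proj G)" "hd q = orig y" "last q = orig (last (y # p))"
    "set q \<subseteq> orig ` set (y # p)" by auto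
  then have "q \<noteq> []" by auto
  \<comment> \<open>An arc whose ends have the same \<open>orig\<close> adds nothing to the
    projected walk; any other arc projects to an arc of \<open>G\<close>.\<close>
  from Cons orig_arc consider "orig x = orig y" | "(orig x, orig y) \<in> parcs G" by auto
  then show ?case
  proof cases
    case 1
    with q show ?thesis by (intro exI[of _ q]) auto
  next
    case 2
    with q \<open>q \<noteq> []\<close> show ?thesis
      by (intro exI[of _ "orig x # q"]) (auto intro!: vwalk_wf_digraph_consI)
  qed
qed

text \<open>The only predecessor of a copy other than the first is the preceding copy, and the only
  successor of a copy other than the last is the next one. A walk with neither end in the chain is
  therefore forced back to copy 0 and from there forward through all copies.\<close>

lemma vwalk_traverses_chain:
  assumes p: "vwalk p (with_proj H)" and x: "prod_encode (v, i) \<in> set p"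
    and v: "v \<noteq> orig (hd p)" "v \<noteq> orig (last p)" and j: "j < k v"
  shows "prod_encode (v, j) \<in> set p"
proof -
  \<comment> \<open>Natural subtraction stops at 0, so \<open>m = i\<close> reaches the first copy
    and larger \<open>m\<close> stays there.\<close>
  have earlier: "prod_encode (v, i - m) \<in> set p" for m
  proof (induction m)
    case (Suc m)
    show ?case
    proof (cases "i - m")
      case (Suc l)
      have "prod_encode (v, Suc l) \<noteq> hd p" using v(1) by (rule prod_encode_neq)
      with vwalk_pred[OF p] Suc.IH Suc chain_arc_in have "prod_encode (v, l) \<in> set p"
        by fastforce
      moreover have "i - Suc m = l" using Suc by simp
      ultimately show ?thesis by simp
    qed (use Suc in simp)
  qed (use x in simp)
  show ?thesis
    using j
  proof (induction j)
    case 0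
    show ?case using earlier[of i] by simp
  next
    case (Suc j)
    have "prod_encode (v, j) \<noteq> last p" using v(2) by (rule prod_encode_neq)
    with vwalk_succ[OF p] Suc chain_arc_out show ?case by fastforce
  qed
qed

text \<open>Walks grow at the front, so the chain is attached from its last copy backwards:
  \<open>m\<close> counts the copies already prepended, and \<open>m = k v\<close> gives the whole
  chain.\<close>

lemma vwalk_chain:
  assumes "v \<in> pverts G" "p \<noteq> []" "vwalk p (with_proj H)"
    and "(prod_encode (v, k v - 1), hd p) \<in> parcs H" and "m \<le> k v"
  shows "vwalk (map (\<lambda>i. prod_encode (v, i)) [k v - m..<k v] @ p) (with_proj H)"
  using \<open>m \<le> k v\<close>
proof (induction m)
  case (Suc m)
  let ?l = "k v - Suc m"
  have upt: "[?l..<k v] = ?l # [Suc ?l..<k v]" and l: "Suc ?l = k v - m"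
    using Suc.prems by (simp_all add: upt_conv_Cons)
  have "(prod_encode (v, ?l), hd (map (\<lambda>i. prod_encode (v, i)) [Suc ?l..<k v] @ p)) \<in> parcs H"
  proof (cases m)
    case 0
    then show ?thesis using assms l by simp
  next
    case (Suc m')
    then have "Suc ?l < k v" using Suc.prems l by simp
    then show ?thesis using assms by (auto simp: upt_conv_Cons chain_graph_def)
  qed
  then show ?case
    using Suc assms(1) unfolding upt l by (auto intro!: vwalk_consI)
qed (use assms in simp)

lemma vwalk_chains:
  assumes "vwalk (s # vs @ [t]) (with_proj G)"
  shows "vwalk (prod_encode (s, k s - 1) #
           concat (map (\<lambda>v. map (\<lambda>i. prod_encode (v, i)) [0..<k v]) vs) @ [prod_encode (t, 0)])
         (with_proj H)"
  using assms
proof (induction vs arbitrary: s)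
  case Nil
  then show ?case
    using k_pos by (auto simp: vwalk_def chain_graph_def)
next
  case (Cons v vs)
  let ?c = "map (\<lambda>i. prod_encode (v, i)) [0..<k v]"
  let ?r = "concat (map (\<lambda>v. map (\<lambda>i. prod_encode (v, i)) [0..<k v]) vs) @ [prod_encode (t, 0)]"
  from Cons.prems have v: "v \<in> pverts G" and s: "s \<in> pverts G" "(s, v) \<in> parcs G"
    and "vwalk (v # vs @ [t]) (with_proj G)" by (auto simp: vwalk_def)
  from Cons.IH[OF this(4)] have r: "vwalk (prod_encode (v, k v - 1) # ?r) (with_proj H)" .
  then have "vwalk ?r (with_proj H)" "(prod_encode (v, k v - 1), hd ?r) \<in> parcs H"
    by (auto elim: vwalk_consE)
  from vwalk_chain[OF v _ this order_refl] have "vwalk (?c @ ?r) (with_proj H)" by simp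
  moreover have "hd (?c @ ?r) = prod_encode (v, 0)"
    using k_pos[of v] by (simp add: hd_append hd_map)
  ultimately have "vwalk (prod_encode (s, k s - 1) # ?c @ ?r) (with_proj H)"
    using s k_pos by (intro vwalk_consI) (auto simp: chain_graph_def)
  then show ?case by simp
qed

text \<open>A path of \<open>H\<close> projects to a walk of \<open>G\<close>, hence contains the
  projection of a path \<open>q\<close> with interior weight at least 1. It traverses the full chain
  over each interior vertex of \<open>q\<close>, and each chain weighs at least as much as its
  vertex.\<close>

lemma vdist_chain_graph:
  assumes dist: "vdist G w s t \<ge> 1" and "s \<noteq> t"
    and weight: "\<And>v. v \<in> pverts G \<Longrightarrow> w v \<le> \<delta> * real (k v)" and "0 \<le> \<delta>"
  shows "vdist H (\<lambda>_. \<delta>) (prod_encode (s, k s - 1)) (prod_encode (t, 0)) \<ge> 1"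
  unfolding vdist_def
proof (rule INF_greatest)
  fix p assume p_st: "p \<in> st_paths H (prod_encode (s, k s - 1)) (prod_encode (t, 0))"
  then have p: "vwalk p (with_proj H)" "distinct p" "hd p = prod_encode (s, k s - 1)"
    "last p = prod_encode (t, 0)" by (auto simp: st_paths_def vpath_def)
  from vwalk_orig[OF p(1)] p obtain q' where q': "vwalk q' (with_proj G)" "hd q' = s" "last q' = t"
    "set q' \<subseteq> orig ` set p" by auto
  then obtain q where q: "q \<in> st_paths G s t" "set q \<subseteq> orig ` set p"
    by (metis vwalk_imp_st_path subset_trans)
  let ?I = "set (interior q)"
  have I: "?I = set q - {s, t}"
    using q(1) \<open>s \<noteq> t\<close> set_interior[of q] by (auto simp: st_paths_def vpath_def)
  \<comment> \<open>Vertices of \<open>?I\<close> differ from \<open>s\<close> and \<open>t\<close>,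
    so their chains contain neither end of \<open>p\<close> and must be traversed entirely.\<close>
  have "prod_encode ` (SIGMA v:?I. {..<k v}) \<subseteq> set p - {hd p, last p}"
  proof clarify
    fix v i assume v: "v \<in> ?I" "i < k v"
    with I q(2) obtain x where "x \<in> set p" "v = orig x" by auto
    then have "prod_encode (v, snd (prod_decode x)) \<in> set p" by simp
    moreover have "v \<noteq> orig (hd p)" "v \<noteq> orig (last p)" using v I p by auto
    moreover from this have "prod_encode (v, i) \<noteq> hd p" "prod_encode (v, i) \<noteq> last p"
      by (auto intro!: prod_encode_neq)
    ultimately show "prod_encode (v, i) \<in> set p - {hd p, last p}"
      using vwalk_traverses_chain[OF p(1) _ _ _ v(2)] by auto
  qed
  also have "\<dots> = set (interior p)"
    using p \<open>s \<noteq> t\<close> by (subst set_interior) auto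
  finally have "card (prod_encode ` (SIGMA v:?I. {..<k v})) \<le> card (set (interior p))"
    by (intro card_mono) auto
  then have card: "(\<Sum>v\<in>?I. k v) \<le> card (set (interior p))"
    by (simp add: card_prod_encode_Sigma)
  have "1 \<le> ereal (\<Sum>v\<in>?I. w v)"
    using dist unfolding vdist_def by (rule order_trans) (rule INF_lower[OF q(1)])
  then have "1 \<le> (\<Sum>v\<in>?I. w v)" by simp
  also have "\<dots> \<le> (\<Sum>v\<in>?I. \<delta> * real (k v))"
    using interior_subset[OF q(1)] weight by (intro sum_mono) auto
  also have "\<dots> = \<delta> * real (\<Sum>v\<in>?I. k v)"
    by (simp add: sum_distrib_left)
  also have "\<dots> \<le> \<delta> * real (card (set (interior p)))"
    using card \<open>0 \<le> \<delta>\<close> by (intro mult_left_mono) (auto simp del: of_nat_sum)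
  finally show "1 \<le> ereal (\<Sum>v\<in>set (interior p). \<delta>)" by (simp add: mult.commute)
qed

text \<open>A path of \<open>G\<close> lifts to a walk of \<open>H\<close> through the chains of its
  interior, and shortcutting yields a path that \<open>X\<close> must hit. Starting at the last copy
  of \<open>s\<close> and ending at the first copy of \<open>t\<close> ensures that the hit lies in
  the chain of an interior vertex.\<close>

lemma integral_vertex_cut_orig:
  assumes cut: "integral_vertex_cut H (\<lambda>_. \<delta>) X"
    and weight: "\<And>v. v \<in> pverts G \<Longrightarrow> w v \<le> \<delta> * real (k v)" and "0 \<le> \<delta>"
  shows "integral_vertex_cut G w (orig ` X)"
  unfolding integral_vertex_cut_def
proof (intro conjI ballI impI)
  show "orig ` X \<subseteq> pverts G"
    using cut by (auto simp: integral_vertex_cut_def pverts_chain_graph)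
next
  fix s t p
  assume st: "s \<in> pverts G" "t \<in> pverts G" and dist: "vdist G w s t \<ge> 1"
    and p: "p \<in> st_paths G s t"
  \<comment> \<open>The trivial path \<open>[s]\<close> has empty interior, so a vertex has distance
    at most 0 to itself.\<close>
  have "s \<noteq> t"
    using vdist_self[OF st(1), of w] dist by (auto dest: order_trans)
  let ?s = "prod_encode (s, k s - 1)" and ?t = "prod_encode (t, 0)"
  let ?c = "concat (map (\<lambda>v. map (\<lambda>i. prod_encode (v, i)) [0..<k v]) (interior p))"
  have "vwalk (s # interior p @ [t]) (with_proj G)"
    using p st_paths_hd_last[OF p \<open>s \<noteq> t\<close>] by (simp add: st_paths_def vpath_def)
  from vwalk_imp_st_path[OF vwalk_chains[OF this]]
  obtain q where q: "q \<in> st_paths H ?s ?t" "set q \<subseteq> set (?s # ?c @ [?t])"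
    by auto
  have "?s \<in> pverts H" "?t \<in> pverts H"
    using st k_pos by auto
  with cut vdist_chain_graph[OF dist \<open>s \<noteq> t\<close> weight \<open>0 \<le> \<delta>\<close>] q(1)
  have "set (interior q) \<inter> X \<noteq> {}"
    unfolding integral_vertex_cut_def by blast
  then obtain x where x: "x \<in> set (interior q)" "x \<in> X" by auto
  have "set (interior q) = set q - {?s, ?t}"
    using q(1) \<open>s \<noteq> t\<close> set_interior[of q] by (auto simp: st_paths_def vpath_def)
  moreover have "set q \<subseteq> insert ?s (insert ?t (set ?c))"
    using q(2) by (simp only: list.set set_append) blast
  ultimately have "x \<in> set ?c" using x(1) by blast
  then have "orig x \<in> set (interior p)" by auto
  with x show "set (interior p) \<inter> orig ` X \<noteq> {}" by auto
qed

end

section \<open>Choice of the quantum and the final bound\<close>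

lemma vuufg_cut:
  fixes G :: "nat pair_pre_digraph"
  assumes "weighted_instance n W G w" "\<forall>u\<in>pverts G. \<forall>v\<in>pverts G. w u = w v"
  shows "\<exists>X. integral_vertex_cut G w X \<and> real (card X) \<le> W * real (vuufg n W)"
proof -
  have "\<forall>(G :: nat pair_pre_digraph) w.
     weighted_instance n W G w \<and> (\<forall>u\<in>pverts G. \<forall>v\<in>pverts G. w u = w v) \<longrightarrow>
     (\<exists>X. integral_vertex_cut G w X \<and> real (card X) \<le> (\<Sum>v\<in>pverts G. w v) * real (vuufg n W))"
    \<comment> \<open>The value \<open>n\<close> is admissible by \<open>cut_le_size\<close>, so the
      \<open>LEAST\<close> satisfies its own condition.\<close>
    unfolding vuufg_def by (rule LeastI[of _ n]) (use cut_le_size in blast)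
  moreover have "(\<Sum>v\<in>pverts G. w v) = W"
    using assms(1) by (simp add: weighted_instance_def)
  ultimately show ?thesis using assms by metis
qed

text \<open>Serves the case \<open>W = 0\<close>, where the quantum would vanish: all interior
  weights are 0, so pairs at distance at least 1 are joined by no path.\<close>

lemma integral_vertex_cut_empty:
  assumes "\<And>v. v \<in> pverts G \<Longrightarrow> w v = 0"
  shows "integral_vertex_cut G w {}"
proof -
  have False if "vdist G w s t \<ge> 1" "p \<in> st_paths G s t" for s t p
  proof -
    have "1 \<le> ereal (\<Sum>v\<in>set (interior p). w v)"
      using that(1) unfolding vdist_def by (rule order_trans) (rule INF_lower[OF that(2)])
    also have "(\<Sum>v\<in>set (interior p). w v) = 0"
      using interior_subset[OF that(2)] assms by (intro sum.neutral) auto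
    finally show False by simp
  qed
  then show ?thesis by (auto simp: integral_vertex_cut_def)
qed

lemma cut_from_uniform:
  fixes G :: "nat pair_pre_digraph"
  assumes inst: "weighted_instance n W G w" and "0 < W"
  shows "\<exists>X n' W'. integral_vertex_cut G w X \<and> real n' \<le> 2 * real n \<and> 0 \<le> W' \<and> W' \<le> 2 * W \<and>
           real (card X) \<le> W' * real (vuufg n' W')"
proof -
  define \<delta> where "\<delta> = W / real n"
  \<comment> \<open>The extra copy rounds the weight up and gives even a vertex of weight 0 a
    nonempty chain. It costs at most \<open>n\<close> copies in total, on top of the at most
    \<open>W / \<delta> = n\<close> copies from the floors.\<close>
  define k where "k v = nat \<lfloor>w v / \<delta>\<rfloor> + 1" for v
  have G: "pair_fin_digraph G" and n: "card (pverts G) = n"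
    and nonneg: "\<And>v. v \<in> pverts G \<Longrightarrow> 0 \<le> w v" and W: "(\<Sum>v\<in>pverts G. w v) = W"
    using inst by (auto simp: weighted_instance_def)
  interpret chain_digraph G k
    using G by (simp add: chain_digraph_def chain_digraph_axioms_def k_def)
  have "pverts G \<noteq> {}" using W \<open>0 < W\<close> by auto
  then have "0 < n" using n pair_finite_verts by auto
  then have "0 < \<delta>" using \<open>0 < W\<close> by (simp add: \<delta>_def)
  have k_ge: "w v \<le> \<delta> * real (k v)" if "v \<in> pverts G" for v
  proof -
    have "w v / \<delta> \<le> real (k v)"
      using nonneg[OF that] \<open>0 < \<delta>\<close> unfolding k_def by (simp add: of_nat_nat) linarith
    then show ?thesis using \<open>0 < \<delta>\<close> by (simp add: field_simps)
  qed
  have k_le: "real (k v) \<le> w v / \<delta> + 1" if "v \<in> pverts G" for v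
    using nonneg[OF that] \<open>0 < \<delta>\<close> by (simp add: k_def)
  define n' where "n' = card (pverts H)"
  define W' where "W' = \<delta> * real n'"
  have "n' = (\<Sum>v\<in>pverts G. k v)"
    using pair_finite_verts by (simp add: n'_def pverts_chain_graph card_prod_encode_Sigma)
  then have "real n' \<le> (\<Sum>v\<in>pverts G. w v / \<delta> + 1)"
    using k_le by (simp add: sum_mono)
  also have "\<dots> = W / \<delta> + real n"
    by (simp add: sum.distrib W n flip: sum_divide_distrib)
  also have "\<dots> = 2 * real n"
    using \<open>0 < n\<close> \<open>0 < W\<close> by (simp add: \<delta>_def)
  finally have n': "real n' \<le> 2 * real n" .
  then have "W' \<le> \<delta> * (2 * real n)"
    unfolding W'_def using \<open>0 < \<delta>\<close> by (intro mult_left_mono) auto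
  then have W': "W' \<le> 2 * W" using \<open>0 < n\<close> by (simp add: \<delta>_def)
  have "0 \<le> W'" using \<open>0 < \<delta>\<close> by (simp add: W'_def)
  have "weighted_instance n' W' H (\<lambda>_. \<delta>)"
    using pair_fin_digraph_chain_graph \<open>0 < \<delta>\<close>
    by (simp add: weighted_instance_def n'_def W'_def mult.commute)
  \<comment> \<open>Encoding copies by \<open>prod_encode\<close> makes \<open>H\<close> a graph on
    \<open>nat\<close>, the type over which \<open>vuufg\<close> quantifies.\<close>
  from vuufg_cut[OF this] obtain X where X: "integral_vertex_cut H (\<lambda>_. \<delta>) X"
    "real (card X) \<le> W' * real (vuufg n' W')" by auto
  have "finite X"
    using X(1) pair_fin_digraph.pair_finite_verts[OF pair_fin_digraph_chain_graph]
    by (auto simp: integral_vertex_cut_def intro: finite_subset)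
  then have "real (card (orig ` X)) \<le> W' * real (vuufg n' W')"
    using card_image_le[of X orig] X(2) by linarith
  with integral_vertex_cut_orig[OF X(1) k_ge] \<open>0 < \<delta>\<close> n' \<open>0 \<le> W'\<close> W' show ?thesis
    by (meson less_imp_le)
qed

theorem theorem6:
  shows "\<exists>C::real. C > 0 \<and>
    (\<forall>(n::nat) (W::real). 0 \<le> W \<longrightarrow>
       real (vufg n W) \<le>
         C * real (Max {vuufg n' W' | n' W'. real n' \<le> C * real n \<and> 0 \<le> W' \<and> W' \<le> C * W}))"
\<comment> \<open>The chain graph at most doubles both size and weight. The outer factor 2 is paid
  because the cut is bounded in terms of \<open>W' \<le> 2 * W\<close>, while \<open>vufg\<close>
  measures it against \<open>W\<close>.\<close>
proof (intro exI[of _ 2] conjI allI impI)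
  fix n :: nat and W :: real
  assume "0 \<le> W"
  let ?S = "{vuufg n' W' | n' W'. real n' \<le> 2 * real n \<and> 0 \<le> W' \<and> W' \<le> 2 * W}"
  have "vufg n W \<le> 2 * Max ?S"
    unfolding vufg_def
  proof (rule Least_le, intro allI impI)
    fix G :: "nat pair_pre_digraph" and w
    assume inst: "weighted_instance n W G w"
    then have W: "(\<Sum>v\<in>pverts G. w v) = W" by (simp add: weighted_instance_def)
    show "\<exists>X. integral_vertex_cut G w X \<and> real (card X) \<le> (\<Sum>v\<in>pverts G. w v) * real (2 * Max ?S)"
    proof (cases "W = 0")
      case True
      with inst have "w v = 0" if "v \<in> pverts G" for v
        using that sum_nonneg_eq_0_iff[of "pverts G" w]
        by (auto simp: weighted_instance_def dest: pair_fin_digraph.pair_finite_verts)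
      then have "integral_vertex_cut G w {}" by (rule integral_vertex_cut_empty)
      with True W show ?thesis by (intro exI[of _ "{}"]) simp
    next
      case False
      with \<open>0 \<le> W\<close> have "0 < W" by simp
      from cut_from_uniform[OF inst this] obtain X n' W' where X: "integral_vertex_cut G w X"
        and n': "real n' \<le> 2 * real n" and W': "0 \<le> W'" "W' \<le> 2 * W"
        and card: "real (card X) \<le> W' * real (vuufg n' W')" by auto
      have "vuufg n' W' \<le> Max ?S"
        using n' W' finite_vuufg_values by (intro Max_ge) auto
      then have "W' * real (vuufg n' W') \<le> 2 * W * real (Max ?S)"
        using W' by (intro mult_mono) auto
      with card X W show ?thesis by (auto simp: mult_ac)
    qed
  qed
  then show "real (vufg n W) \<le> 2 * real (Max ?S)" by linarith
qed simp

end
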